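(* Assume $\Diamond(E^{\mathfrak c}_\omega)$ and $\mathfrak p=\mathfrak c$. Then there exists a nonprincipal ultrafilter $\mathcal U$ on $\omega$ such that $\mathcal U$ is not a P-point and $$\mathfrak c<_T\langle\mathcal U,\supseteq^*\rangle\leq_T\langle\mathcal U,\supseteq\rangle<_T\langle[\mathfrak c]^{<\omega},\subseteq\rangle .$$
   Context: A quasiorder is a set with a reflexive transitive relation $\leq$. A quasiorder is $\kappa$-directed if every subset of size less than $\kappa$ has an upper bound in it; directed means $\omega$-directed. For directed sets $P,Q$, a map $f\colon P\to Q$ is Tukey if the $f$-image of every unbounded subset of $P$ is unbounded in $Q$; $P\leq_T Q$ means a Tukey map $P\to Q$ exists; $P\equiv_T Q$ means $P\leq_T Q\leq_T P$; $P<_T Q$ means $P\leq_T Q$ and $Q\not\leq_T P$. $A\supseteq^* B$ means $B\setminus A$ is finite. $\langle\mathcal U,\supseteq\rangle$ and $\langle\mathcal U,\supseteq^*\rangle$ denote $\mathcal U$ quasiordered so that $A\leq B$ iff $A\supseteq B$, respectively $A\supseteq^* B$. $\mathcal U$ is a P-point if $\langle\mathcal U,\supseteq^*\rangle$ is $\omega_1$-directed. $\mathfrak c=2^{\aleph_0}$; as a directed set $\mathfrak c$ is ordered as an ordinal. $[\mathfrak c]^{<\omega}$ is the set of finite subsets of $\mathfrak c$, ordered by $\subseteq$. A family $\mathcal A\subseteq\mathcal P(\omega)$ has the strong finite intersection property (SFIP) if $\bigcap\sigma$ is infinite for every finite $\sigma\subseteq\mathcal A$. A nontrivial pseudointersection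 of $\mathcal A$ is an infinite $b\subseteq\omega$ with $b\setminus a$ finite for all $a\in\mathcal A$. $\mathfrak p$ is the least cardinality of a family of infinite subsets of $\omega$ that has the SFIP but has no nontrivial pseudointersection. $E^\kappa_\lambda=\{\alpha<\kappa:\operatorname{cf}(\alpha)=\lambda\}$. For a stationary $S\subseteq\kappa$ ($\kappa$ regular uncountable), $\Diamond(S)$ is the assertion that there is a sequence $\langle\Xi_\alpha\rangle_{\alpha\in S}$ with $\Xi_\alpha\subseteq\alpha$ such that for every $X\subseteq\kappa$ the set $\{\alpha\in S: X\cap\alpha=\Xi_\alpha\}$ is stationary in $\kappa$. (Here $\mathfrak p=\mathfrak c$ implies $\mathfrak c$ is regular.) *)

theory Defs
  imports Main
begin

unbundle cardinal_syntax

text \<open>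
  A quasiorder is a relation \<open>r\<close> with \<open>Preorder r\<close>; its underlying set is \<open>Field r\<close>.
  A cardinal or an ordinal is a (non-strict) well-order; an ordinal below \<open>\<kappa>\<close> is an element
  \<open>\<alpha>\<close> of \<open>Field \<kappa>\<close>, and the set of its predecessors is \<open>underS \<kappa> \<alpha>\<close>.
\<close>

section \<open>Directed sets and the Tukey order\<close>

definition bounded_in :: "'a rel \<Rightarrow> 'a set \<Rightarrow> bool" where
  "bounded_in r X \<longleftrightarrow> (\<exists>u\<in>Field r. \<forall>x\<in>X. (x, u) \<in> r)"

definition card_directed :: "'k rel \<Rightarrow> 'a rel \<Rightarrow> bool" where
  "card_directed \<kappa> r \<longleftrightarrow>
     Preorder r \<and> (\<forall>X. X \<subseteq> Field r \<and> |X| <o \<kappa> \<longrightarrow> bounded_in r X)"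

abbreviation directed :: "'a rel \<Rightarrow> bool" where
  "directed \<equiv> card_directed natLeq"

definition tukey_map :: "'a rel \<Rightarrow> 'b rel \<Rightarrow> ('a \<Rightarrow> 'b) \<Rightarrow> bool" where
  "tukey_map P Q f \<longleftrightarrow>
     f ` Field P \<subseteq> Field Q \<and>
     (\<forall>X. X \<subseteq> Field P \<and> \<not> bounded_in P X \<longrightarrow> \<not> bounded_in Q (f ` X))"

definition tukey_le :: "'a rel \<Rightarrow> 'b rel \<Rightarrow> bool" (infix \<open>\<le>\<^sub>T\<close> 50) where
  "P \<le>\<^sub>T Q \<longleftrightarrow> directed P \<and> directed Q \<and> (\<exists>f. tukey_map P Q f)"

definition tukey_less :: "'a rel \<Rightarrow> 'b rel \<Rightarrow> bool" (infix \<open><\<^sub>T\<close> 50) where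
  "P <\<^sub>T Q \<longleftrightarrow> P \<le>\<^sub>T Q \<and> \<not> Q \<le>\<^sub>T P"

definition finite_subsets_order :: "'a set \<Rightarrow> 'a set rel" where
  "finite_subsets_order A = {(F, G). F \<subseteq> G \<and> G \<subseteq> A \<and> finite G}"

section \<open>Ultrafilters on the natural numbers\<close>

definition ultrafilter :: "nat set set \<Rightarrow> bool" where
  "ultrafilter U \<longleftrightarrow>
     UNIV \<in> U \<and> {} \<notin> U \<and>
     (\<forall>A\<in>U. \<forall>B\<in>U. A \<inter> B \<in> U) \<and>
     (\<forall>A\<in>U. \<forall>B. A \<subseteq> B \<longrightarrow> B \<in> U) \<and>
     (\<forall>A. A \<in> U \<or> - A \<in> U)"

definition nonprincipal :: "nat set set \<Rightarrow> bool" where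
  "nonprincipal U \<longleftrightarrow> (\<nexists>n. U = {A. n \<in> A})"

definition superset_order :: "nat set set \<Rightarrow> nat set rel" where
  "superset_order U = {(A, B). A \<in> U \<and> B \<in> U \<and> A \<supseteq> B}"

definition almost_superset_order :: "nat set set \<Rightarrow> nat set rel" where
  "almost_superset_order U = {(A, B). A \<in> U \<and> B \<in> U \<and> finite (B - A)}"

text \<open>Here \<open>cardSuc natLeq\<close> is \<open>\<omega>\<^sub>1\<close>.\<close>

definition P_point :: "nat set set \<Rightarrow> bool" where
  "P_point U \<longleftrightarrow> card_directed (cardSuc natLeq) (almost_superset_order U)"

section \<open>The cardinals c and p\<close>

text \<open>The well-order of least order type on \<open>nat set\<close>, so also the ordinal c.\<close>

definition continuum :: "nat set rel" where
  "continuum = |UNIV :: nat set set|"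

text \<open>
  Meaningful for nonempty \<open>\<A>\<close>, and then determined up to order isomorphism; a minimum exists
  by \<open>exists_minim_Card_order\<close>.
\<close>

definition least_card :: "'a set set \<Rightarrow> 'a rel" where
  "least_card \<A> = (SOME r. \<exists>A\<in>\<A>. r = |A| \<and> (\<forall>B\<in>\<A>. |A| \<le>o |B| ))"

text \<open>For \<open>\<sigma> = {}\<close> the intersection is \<open>UNIV\<close>, which is infinite.\<close>

definition SFIP :: "nat set set \<Rightarrow> bool" where
  "SFIP \<A> \<longleftrightarrow> (\<forall>\<sigma>. \<sigma> \<subseteq> \<A> \<and> finite \<sigma> \<longrightarrow> infinite (\<Inter>\<sigma>))"

definition nontrivial_pseudointersection :: "nat set set \<Rightarrow> nat set \<Rightarrow> bool" where
  "nontrivial_pseudointersection \<A> b \<longleftrightarrow> infinite b \<and> (\<forall>a\<in>\<A>. finite (b - a))"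

text \<open>
  The collection of families below is nonempty: every nonprincipal ultrafilter belongs to it.
\<close>

definition pseudointersection_number :: "nat set rel" where
  "pseudointersection_number =
     least_card {\<A>. (\<forall>a\<in>\<A>. infinite a) \<and> SFIP \<A> \<and>
                    (\<nexists>b. nontrivial_pseudointersection \<A> b)}"

section \<open>Cofinality, stationary sets and diamond\<close>

text \<open>
  Cofinal is meant in the non-strict sense here, so that successor ordinals have cofinality 1;
  the library constant \<^const>\<open>cofinal\<close> is strict.
\<close>

definition cf_below :: "'k rel \<Rightarrow> 'k \<Rightarrow> 'k rel" where
  "cf_below \<kappa> \<alpha> =
     least_card {X. X \<subseteq> underS \<kappa> \<alpha> \<and> (\<forall>\<beta>\<in>underS \<kappa> \<alpha>. \<exists>\<xi>\<in>X. (\<beta>, \<xi>) \<in> \<kappa>)}"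

definition cof_set :: "'k rel \<Rightarrow> 'l rel \<Rightarrow> 'k set" where
  "cof_set \<kappa> \<mu> = {\<alpha> \<in> Field \<kappa>. cf_below \<kappa> \<alpha> =o \<mu>}"

text \<open>
  By strictness of \<^const>\<open>cofinal\<close>, the second condition concerns only those \<open>\<alpha>\<close> that are
  nonzero limits and limit points of \<open>C\<close>.
\<close>

definition club :: "'k rel \<Rightarrow> 'k set \<Rightarrow> bool" where
  "club \<kappa> C \<longleftrightarrow>
     C \<subseteq> Field \<kappa> \<and> cofinal C \<kappa> \<and>
     (\<forall>\<alpha>\<in>Field \<kappa>. underS \<kappa> \<alpha> \<noteq> {} \<and>
        cofinal (C \<inter> underS \<kappa> \<alpha>) (Restr \<kappa> (underS \<kappa> \<alpha>)) \<longrightarrow> \<alpha> \<in> C)"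

definition stationary :: "'k rel \<Rightarrow> 'k set \<Rightarrow> bool" where
  "stationary \<kappa> S \<longleftrightarrow> S \<subseteq> Field \<kappa> \<and> (\<forall>C. club \<kappa> C \<longrightarrow> S \<inter> C \<noteq> {})"

definition diamond :: "'k rel \<Rightarrow> 'k set \<Rightarrow> bool" where
  "diamond \<kappa> S \<longleftrightarrow>
     (\<exists>\<Xi> :: 'k \<Rightarrow> 'k set.
        (\<forall>\<alpha>\<in>S. \<Xi> \<alpha> \<subseteq> underS \<kappa> \<alpha>) \<and>
        (\<forall>X. X \<subseteq> Field \<kappa> \<longrightarrow> stationary \<kappa> {\<alpha>\<in>S. X \<inter> underS \<kappa> \<alpha> = \<Xi> \<alpha>}))"

end

theory Submission
  imports Defs "HOL-Library.Nat_Bijection" "HOL-Library.Countable_Set"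
begin

text \<open>
  From \<open>\<pp> = \<cc>\<close> one gets a P-point \<open>V\<close> generated by a tower of length \<open>\<cc>\<close>, decreasing modulo
  finite sets. The ultrafilter \<open>U\<close> is the Fubini square of \<open>V\<close>, which is never a P-point.

  The relation \<open>\<cc> \<le>\<^sub>T U\<close> holds for every nonprincipal ultrafilter: fewer than \<open>\<cc>\<close> elements of
  \<open>U\<close> have a pseudointersection, so they do not generate \<open>U\<close>, and the \<open>\<alpha>\<close>-th value of the Tukey
  map can avoid what the first \<open>\<alpha>\<close> elements generate. A converse Tukey map would make \<open>U\<close> a
  P-point, as \<open>\<cc>\<close> has uncountable cofinality.

  For the last relation it suffices that any \<open>\<phi> : \<cc> \<rightarrow> U\<close> has infinitely many arguments
  whose values have their intersection in \<open>U\<close>. By second countability of the Cantor space there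
  are distinct \<open>x\<^sub>k\<close> such that the \<open>\<phi> x\<^sub>k\<close>, and the sets of rows of \<open>\<phi> x\<^sub>k\<close> that lie in \<open>V\<close>,
  converge to the corresponding sets for some \<open>\<phi> x\<close>. Pseudointersections in \<open>V\<close> of the
  rows then differ from the rows of \<open>\<phi> x\<^sub>k\<close> on consecutive finite intervals only; \<open>V\<close>
  omits the union of the even or of the odd intervals, so the corresponding half of
  the sequence works for all rows at once.
\<close>

section \<open>The ordinal of the continuum\<close>

text \<open>Pairing identifies a set of naturals with a subset of the plane, so that one set codes a
  sequence of sets. Koenig's argument uses it to code sequences of ordinals, the Fubini square to
  speak of vertical sections.\<close>

definition row :: "nat \<Rightarrow> nat set \<Rightarrow> nat set" where
  "row n A = {m. prod_encode (n, m) \<in> A}"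

lemma row_surj: "\<exists>A. \<forall>n. row n A = f n"
proof
  show "\<forall>n. row n {p. snd (prod_decode p) \<in> f (fst (prod_decode p))} = f n"
    by (simp add: row_def)
qed

lemma row_mono: "A \<subseteq> B \<Longrightarrow> row n A \<subseteq> row n B"
  by (auto simp: row_def)

lemma row_Int: "row n (A \<inter> B) = row n A \<inter> row n B"
  by (auto simp: row_def)

lemma row_Compl: "row n (- A) = - row n A"
  by (auto simp: row_def)

lemma row_INT: "row n (\<Inter>k\<in>K. A k) = (\<Inter>k\<in>K. row n (A k))"
  by (auto simp: row_def)

lemma Field_continuum [simp]: "Field continuum = UNIV"
  by (simp add: continuum_def Field_card_of)

lemma Well_order_continuum: "well_order_on UNIV continuum"
  by (simp add: continuum_def card_of_well_order_on)

lemma wf_continuum: "wf (continuum - Id)"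
  using Well_order_continuum by (simp add: well_order_on_def)

lemma Preorder_continuum: "Preorder continuum"
  using Well_order_continuum
  by (simp add: well_order_on_def linear_order_on_def partial_order_on_def)

lemma not_underS_continuum: "x \<notin> underS continuum y \<longleftrightarrow> (y, x) \<in> continuum"
proof -
  have "total_on UNIV continuum" "antisym continuum" "refl continuum"
    using Well_order_continuum
    by (auto simp: well_order_on_def linear_order_on_def partial_order_on_def preorder_on_def)
  then show ?thesis
    unfolding total_on_def underS_def antisym_def refl_on_def by (cases "x = y") auto
qed

lemma underS_continuum: "|underS continuum x| <o continuum"
  unfolding continuum_def by (rule card_of_underS[OF card_of_Card_order]) (simp add: Field_card_of)

lemma finite_max_continuum:
  assumes "finite F" "F \<noteq> {}"
  shows "\<exists>M\<in>F. \<forall>x\<in>F. (x, M) \<in> continuum"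
  using assms
proof (induction rule: finite_ne_induct)
  case (singleton x)
  show ?case using Preorder_continuum by (auto simp: preorder_on_def refl_on_def)
next
  case (insert x F)
  then obtain M where M: "M \<in> F" "\<forall>y\<in>F. (y, M) \<in> continuum" by blast
  have refl: "(x, x) \<in> continuum" and trans: "trans continuum"
    using Preorder_continuum by (auto simp: preorder_on_def refl_on_def)
  have "(x, M) \<in> continuum \<or> (M, x) \<in> continuum"
    using not_underS_continuum[of M x] by (auto simp: underS_def)
  then show ?case
  proof
    assume "(x, M) \<in> continuum"
    with M show ?thesis by auto
  next
    assume "(M, x) \<in> continuum"
    with M trans refl have "\<forall>y\<in>insert x F. (y, x) \<in> continuum" by (auto dest: transD)
    then show ?thesis by blast
  qed
qed

text \<open>Koenig's diagonal argument, where an element of \<open>nat set\<close> codes a sequence of such elements.\<close>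

lemma countable_bounded_continuum:
  assumes "countable X"
  shows "bounded_in continuum X"
proof (rule ccontr)
  assume unb: "\<not> bounded_in continuum X"
  then have "X \<noteq> {}" by (auto simp: bounded_in_def)
  then obtain a where a: "X = range (a :: nat \<Rightarrow> nat set)"
    using assms by (metis range_from_nat_into)
  \<comment> \<open>Fewer than c predecessors of \<open>a n\<close> cannot realise every set as
    their \<open>n\<close>-th row. A set \<open>x\<close> built from missed rows therefore precedes
    no \<open>a n\<close>.\<close>
  have "row n ` underS continuum (a n) \<noteq> UNIV" for n
  proof
    assume eq: "row n ` underS continuum (a n) = UNIV"
    have "|row n ` underS continuum (a n)| <o continuum"
      using card_of_image underS_continuum ordLeq_ordLess_trans by blast
    then have "|UNIV :: nat set set| <o continuum"
      by (simp only: eq)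
    then show False by (simp add: continuum_def ordLess_irreflexive)
  qed
  then have "\<forall>n. \<exists>y. y \<notin> row n ` underS continuum (a n)" by blast
  then obtain f where f: "\<And>n. f n \<notin> row n ` underS continuum (a n)" by metis
  obtain x where x: "\<And>n. row n x = f n" using row_surj[of f] by blast
  have "x \<notin> underS continuum (a n)" for n
    using f[of n] x[of n] by auto
  then have "(a n, x) \<in> continuum" for n
    by (simp add: not_underS_continuum)
  then show False using unb a by (auto simp: bounded_in_def)
qed

lemma uncountable_nat_sets: "\<not> countable (UNIV :: nat set set)"
proof
  assume "countable (UNIV :: nat set set)"
  then obtain a where "UNIV = range (a :: nat \<Rightarrow> nat set)"
    by (metis range_from_nat_into UNIV_not_empty)
  then show False using Cantors_theorem[of "UNIV :: nat set"] by (metis Pow_UNIV)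
qed

lemma directed_iff:
  "directed r \<longleftrightarrow> Preorder r \<and> (\<forall>X. X \<subseteq> Field r \<and> finite X \<longrightarrow> bounded_in r X)"
  by (simp add: card_directed_def finite_iff_ordLess_natLeq)

lemma directed_continuum: "directed continuum"
  using Preorder_continuum countable_bounded_continuum countable_finite
  by (auto simp: directed_iff)

lemma countable_iff_ordLess_cardSuc: "countable X \<longleftrightarrow> |X| <o cardSuc natLeq"
proof -
  have "|X| <o cardSuc natLeq \<longleftrightarrow> |X| \<le>o natLeq"
    by (rule cardSuc_ordLeq_ordLess[OF natLeq_Card_order card_of_Card_order])
  also have "\<dots> \<longleftrightarrow> |X| \<le>o |UNIV :: nat set|"
    using card_of_nat ordLeq_ordIso_trans ordIso_symmetric by blast
  also have "\<dots> \<longleftrightarrow> countable X"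
    unfolding countable_def card_of_ordLeq[symmetric] by simp
  finally show ?thesis by simp
qed

text \<open>A counterexample would lie in the class that defines p. This class is then nonempty, so
  the choice in \<open>least_card\<close> yields a true minimum, and p would be at most the size of
  \<open>\<A>\<close>, hence below c.\<close>

lemma pseudointersection_exists:
  assumes "pseudointersection_number =o continuum"
    and "|\<A>| <o continuum" "\<And>a. a \<in> \<A> \<Longrightarrow> infinite a" "SFIP \<A>"
  shows "\<exists>b. nontrivial_pseudointersection \<A> b"
proof (rule ccontr)
  assume none: "\<nexists>b. nontrivial_pseudointersection \<A> b"
  define C where
    "C = {\<A>. (\<forall>a\<in>\<A>. infinite a) \<and> SFIP \<A> \<and> (\<nexists>b. nontrivial_pseudointersection \<A> b)}"
  have A: "\<A> \<in> C" using assms none by (simp add: C_def)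
  have "\<exists>r\<in>card_of ` C. \<forall>r'\<in>card_of ` C. r \<le>o r'"
    by (rule exists_minim_Card_order) (use A in \<open>auto simp: card_of_Card_order\<close>)
  then have "\<exists>r. \<exists>A\<in>C. r = |A| \<and> (\<forall>B\<in>C. |A| \<le>o |B| )" by blast
  then have "\<exists>A\<in>C. pseudointersection_number = |A| \<and> (\<forall>B\<in>C. |A| \<le>o |B| )"
    unfolding pseudointersection_number_def least_card_def C_def[symmetric] by (rule someI_ex)
  with A have "pseudointersection_number \<le>o |\<A>|" by auto
  then have "pseudointersection_number <o continuum"
    using assms(2) ordLeq_ordLess_trans by blast
  then show False using assms(1) not_ordLess_ordIso by blast
qed

section \<open>Nonprincipal ultrafilters\<close>

locale free_ultrafilter =
  fixes U :: "nat set set"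
  assumes ultra: "ultrafilter U" and free: "nonprincipal U"
begin

lemma UNIV_mem: "UNIV \<in> U"
  and empty_notin: "{} \<notin> U"
  and Int_mem: "A \<in> U \<Longrightarrow> B \<in> U \<Longrightarrow> A \<inter> B \<in> U"
  and superset_mem: "A \<in> U \<Longrightarrow> A \<subseteq> B \<Longrightarrow> B \<in> U"
  using ultra unfolding ultrafilter_def by blast+

lemma Compl_mem_iff: "- A \<in> U \<longleftrightarrow> A \<notin> U"
  using ultra unfolding ultrafilter_def by (metis Compl_disjoint)

lemma INT_mem: "finite K \<Longrightarrow> (\<And>k. k \<in> K \<Longrightarrow> A k \<in> U) \<Longrightarrow> (\<Inter>k\<in>K. A k) \<in> U"
  by (induction K rule: finite_induct) (auto simp: UNIV_mem Int_mem)

lemma finite_notin: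
  assumes "finite A"
  shows "A \<notin> U"
proof -
  have single: "- {n} \<in> U" for n
  proof (rule ccontr)
    assume "- {n} \<notin> U"
    then have n: "{n} \<in> U" by (simp add: Compl_mem_iff)
    have "A \<in> U \<longleftrightarrow> n \<in> A" for A
    proof
      assume "A \<in> U"
      then have "{n} \<inter> A \<in> U" using n Int_mem by blast
      then show "n \<in> A" using empty_notin by (cases "n \<in> A") auto
    next
      assume "n \<in> A"
      then show "A \<in> U" using n superset_mem[of "{n}" A] by simp
    qed
    then have "U = {A. n \<in> A}" by auto
    then show False using free by (auto simp: nonprincipal_def)
  qed
  have "(\<Inter>n\<in>A. - {n}) \<in> U" using assms single by (rule INT_mem)
  moreover have "(\<Inter>n\<in>A. - {n}) = - A" by auto
  ultimately show ?thesis by (simp add: Compl_mem_iff)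
qed

lemma infinite_mem: "A \<in> U \<Longrightarrow> infinite A"
  using finite_notin by blast

section \<open>Inclusion and almost inclusion on an ultrafilter\<close>

lemma Field_superset_order: "Field (superset_order U) = U"
  by (auto simp: superset_order_def Field_def)

lemma Field_almost_superset_order: "Field (almost_superset_order U) = U"
  by (auto simp: almost_superset_order_def Field_def)

lemma finite_bounded_superset_order:
  assumes "finite X" "X \<subseteq> U"
  shows "bounded_in (superset_order U) X"
proof -
  have "(\<Inter>x\<in>X. x) \<in> U" by (rule INT_mem) (use assms in auto)
  then show ?thesis
    using assms unfolding bounded_in_def Field_superset_order
    by (intro bexI[of _ "\<Inter>x\<in>X. x"]) (auto simp: superset_order_def)
qed

lemma bounded_almost_superset_order:
  assumes "bounded_in (superset_order U) X"
  shows "bounded_in (almost_superset_order U) X"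
proof -
  have "superset_order U \<subseteq> almost_superset_order U"
    by (auto simp: superset_order_def almost_superset_order_def Diff_eq_empty_iff[THEN iffD2])
  then show ?thesis
    using assms unfolding bounded_in_def Field_superset_order Field_almost_superset_order
    by blast
qed

lemma Preorder_superset_order: "Preorder (superset_order U)"
  unfolding preorder_on_def Field_superset_order
  by (auto simp: superset_order_def refl_on_def trans_def)

lemma Preorder_almost_superset_order: "Preorder (almost_superset_order U)"
proof -
  have "trans (almost_superset_order U)"
  proof (rule transI)
    fix A B C assume "(A, B) \<in> almost_superset_order U" "(B, C) \<in> almost_superset_order U"
    then show "(A, C) \<in> almost_superset_order U"
      using finite_subset[of "C - A" "(B - A) \<union> (C - B)"]
      by (auto simp: almost_superset_order_def)
  qed
  then show ?thesis
    unfolding preorder_on_def Field_almost_superset_order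
    by (auto simp: almost_superset_order_def refl_on_def)
qed

lemma directed_superset_order: "directed (superset_order U)"
  using Preorder_superset_order finite_bounded_superset_order
  by (auto simp: directed_iff Field_superset_order)

lemma directed_almost_superset_order: "directed (almost_superset_order U)"
  using Preorder_almost_superset_order finite_bounded_superset_order
    bounded_almost_superset_order
  by (auto simp: directed_iff Field_almost_superset_order)

lemma almost_superset_order_tukey_le: "almost_superset_order U \<le>\<^sub>T superset_order U"
  unfolding tukey_le_def tukey_map_def
  using directed_superset_order directed_almost_superset_order bounded_almost_superset_order
  by (auto simp: Field_superset_order Field_almost_superset_order intro!: exI[of _ id])

lemma continuum_tukey_le:
  assumes "pseudointersection_number =o continuum"
  shows "continuum \<le>\<^sub>T almost_superset_order U"
proof -
  \<comment> \<open>Elements of \<open>U\<close> serve as ordinals themselves: those preceding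
    \<open>x\<close> form a family of fewer than c sets, and \<open>A\<close> is to almost contain
    none of them.\<close>
  have "\<exists>A\<in>U. \<forall>B\<in>U \<inter> underS continuum x. infinite (B - A)" for x
  proof (rule ccontr)
    assume "\<not> ?thesis"
    then have gen: "\<And>A. A \<in> U \<Longrightarrow> \<exists>B\<in>U \<inter> underS continuum x. finite (B - A)" by blast
    let ?A = "U \<inter> underS continuum x"
    have "|?A| \<le>o |underS continuum x|" by (rule card_of_mono1) auto
    then have "|?A| <o continuum" using underS_continuum ordLeq_ordLess_trans by blast
    moreover have "SFIP ?A"
      unfolding SFIP_def
    proof (intro allI impI)
      fix \<sigma> assume "\<sigma> \<subseteq> ?A \<and> finite \<sigma>"
      then have "(\<Inter>a\<in>\<sigma>. a) \<in> U" by (intro INT_mem) auto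
      then show "infinite (\<Inter>\<sigma>)" using infinite_mem by simp
    qed
    ultimately obtain b where b: "infinite b" "\<And>B. B \<in> ?A \<Longrightarrow> finite (b - B)"
      using pseudointersection_exists[OF assms, of ?A] infinite_mem
      by (auto simp: nontrivial_pseudointersection_def)
    have bU: "finite (b - A)" if "A \<in> U" for A
    proof -
      obtain B where "B \<in> ?A" "finite (B - A)" using gen \<open>A \<in> U\<close> by blast
      then have "finite ((b - B) \<union> (B - A))" using b by blast
      then show ?thesis by (rule rev_finite_subset) auto
    qed
    \<comment> \<open>By \<open>bU\<close>, \<open>b\<close> is almost contained in every element of
      \<open>U\<close>. But \<open>U\<close> contains \<open>c\<close> or its complement, which
      misses all of \<open>d\<close> or all of \<open>c\<close>.\<close>
    obtain c d where cd: "c \<inter> d = {}" "c \<subseteq> b" "d \<subseteq> b" "infinite c" "infinite d"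
      using infinite_split[OF b(1)] by metis
    show False
    proof (cases "c \<in> U")
      case True
      then have "finite (b - c)" by (rule bU)
      moreover have "d \<subseteq> b - c" using cd by auto
      ultimately show False using cd finite_subset by blast
    next
      case False
      then have "finite (b - (- c))" using bU Compl_mem_iff by blast
      moreover have "c \<subseteq> b - (- c)" using cd by auto
      ultimately show False using cd finite_subset by blast
    qed
  qed
  then obtain f where f: "\<And>x. f x \<in> U"
    "\<And>x B. B \<in> U \<Longrightarrow> B \<in> underS continuum x \<Longrightarrow> infinite (B - f x)"
    by (metis IntI)
  have "tukey_map continuum (almost_superset_order U) f"
    unfolding tukey_map_def
  proof (intro conjI allI impI notI)
    show "f ` Field continuum \<subseteq> Field (almost_superset_order U)"
      using f by (auto simp: Field_almost_superset_order)
  next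
    fix X assume X: "X \<subseteq> Field continuum \<and> \<not> bounded_in continuum X"
      and "bounded_in (almost_superset_order U) (f ` X)"
    then obtain B where B: "B \<in> U" "\<And>x. x \<in> X \<Longrightarrow> finite (B - f x)"
      by (auto simp: bounded_in_def almost_superset_order_def Field_almost_superset_order)
    \<comment> \<open>The bound \<open>B\<close> of the image, read as an ordinal, bounds
      \<open>X\<close>: by the choice of \<open>f x\<close> it cannot precede any \<open>x\<close>
      in \<open>X\<close>.\<close>
    then have "(x, B) \<in> continuum" if "x \<in> X" for x
      using f(2) that not_underS_continuum by blast
    with X show False by (auto simp: bounded_in_def)
  qed
  then show ?thesis
    using directed_continuum directed_almost_superset_order by (auto simp: tukey_le_def)
qed

text \<open>The Tukey property is used contrapositively: a countable family has a countable, hence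
  bounded, image among the ordinals, so it is bounded itself.\<close>

lemma tukey_le_continuum_imp_P_point:
  assumes "almost_superset_order U \<le>\<^sub>T continuum"
  shows "P_point U"
proof -
  obtain g where g: "tukey_map (almost_superset_order U) continuum g"
    using assms by (auto simp: tukey_le_def)
  have "bounded_in (almost_superset_order U) X" if "countable X" "X \<subseteq> U" for X
    using g countable_bounded_continuum[of "g ` X"] that
    by (auto simp: tukey_map_def Field_almost_superset_order)
  then show ?thesis
    unfolding P_point_def card_directed_def countable_iff_ordLess_cardSuc[symmetric]
    using Preorder_almost_superset_order by (auto simp: Field_almost_superset_order)
qed

end

section \<open>The order of finite subsets\<close>

lemma Field_finite_subsets_order: "Field (finite_subsets_order A) = {F. F \<subseteq> A \<and> finite F}"
  by (auto simp: finite_subsets_order_def Field_def intro: finite_subset)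

lemma directed_finite_subsets_order: "directed (finite_subsets_order A)"
proof -
  have "bounded_in (finite_subsets_order A) X" if "X \<subseteq> {F. F \<subseteq> A \<and> finite F}" "finite X" for X
    unfolding bounded_in_def Field_finite_subsets_order
    using that by (intro bexI[of _ "\<Union>X"]) (auto simp: finite_subsets_order_def)
  then show ?thesis
    unfolding directed_iff preorder_on_def Field_finite_subsets_order
    by (auto simp: finite_subsets_order_def refl_on_def trans_def intro: finite_subset)
qed

lemma bounded_singletons_finite_subsets_order:
  assumes "bounded_in (finite_subsets_order A) ((\<lambda>x. {x}) ` X)"
  shows "finite X"
proof -
  obtain F where "\<forall>x\<in>X. {x} \<subseteq> F \<and> finite F" "F \<in> Field (finite_subsets_order A)"
    using assms by (auto simp: bounded_in_def finite_subsets_order_def)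
  then show ?thesis
    by (metis finite.emptyI finite_subset insert_subset subsetI ex_in_conv)
qed

text \<open>An unbounded family is infinite, and infinitely many singletons have no common finite
  superset. Singletons are available as values since every set of naturals is an element of
  \<open>Field continuum\<close>.\<close>

lemma (in free_ultrafilter) superset_order_tukey_le:
  "superset_order U \<le>\<^sub>T finite_subsets_order (Field continuum)"
proof -
  have "tukey_map (superset_order U) (finite_subsets_order (Field continuum)) (\<lambda>A. {A})"
    unfolding tukey_map_def
  proof (intro conjI allI impI notI)
    show "(\<lambda>A. {A}) ` Field (superset_order U) \<subseteq> Field (finite_subsets_order (Field continuum))"
      by (auto simp: Field_finite_subsets_order)
  next
    fix X assume "X \<subseteq> Field (superset_order U) \<and> \<not> bounded_in (superset_order U) X"
      and "bounded_in (finite_subsets_order (Field continuum)) ((\<lambda>A. {A}) ` X)"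
    then show False
      using bounded_singletons_finite_subsets_order finite_bounded_superset_order
      by (auto simp: Field_superset_order)
  qed
  then show ?thesis
    using directed_superset_order directed_finite_subsets_order by (auto simp: tukey_le_def)
qed

section \<open>A P-point from \<open>\<pp> = \<cc>\<close>\<close>

text \<open>The P-point property is phrased for sequences, the form in which it is applied to
  rows.\<close>

locale P_point_ultrafilter = free_ultrafilter V for V +
  assumes pseudointersection: "\<And>X :: nat \<Rightarrow> nat set. range X \<subseteq> V \<Longrightarrow> \<exists>Y\<in>V. \<forall>k. finite (Y - X k)"

text \<open>The length of the tower is \<open>\<cc>\<close>; a set serves as its own index, and the tower decides it there.\<close>

lemma tower_exists:
  assumes "pseudointersection_number =o continuum"
  shows "\<exists>b. \<forall>A. infinite (b A) \<and> (\<forall>B\<in>underS continuum A. finite (b A - b B)) \<and>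
           (b A \<subseteq> A \<or> b A \<subseteq> - A)"
proof (rule dependent_wf_choice[OF wf_continuum])
  fix f g :: "nat set \<Rightarrow> nat set" and A r
  assume "\<And>B. (B, A) \<in> continuum - Id \<Longrightarrow> f B = g B"
  then have "\<And>B. B \<in> underS continuum A \<Longrightarrow> f B = g B" by (auto simp: underS_def)
  then show "(infinite r \<and> (\<forall>B\<in>underS continuum A. finite (r - f B)) \<and> (r \<subseteq> A \<or> r \<subseteq> - A)) =
     (infinite r \<and> (\<forall>B\<in>underS continuum A. finite (r - g B)) \<and> (r \<subseteq> A \<or> r \<subseteq> - A))"
    by simp
next
  fix A and f :: "nat set \<Rightarrow> nat set"
  assume IH: "\<And>B. (B, A) \<in> continuum - Id \<Longrightarrow>
    infinite (f B) \<and> (\<forall>C\<in>underS continuum B. finite (f B - f C)) \<and> (f B \<subseteq> B \<or> f B \<subseteq> - B)"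
  have inf: "infinite (f B)" if "B \<in> underS continuum A" for B
    using IH that by (auto simp: underS_def)
  have dec: "finite (f B - f C)" if "B \<in> underS continuum A" "(C, B) \<in> continuum" for B C
    using IH[of B] that by (cases "C = B") (auto simp: underS_def)
  let ?A = "f ` underS continuum A"
  have "|?A| <o continuum"
    using card_of_image underS_continuum ordLeq_ordLess_trans by blast
  moreover have "SFIP ?A"
    unfolding SFIP_def
  proof (intro allI impI)
    fix \<sigma> assume "\<sigma> \<subseteq> ?A \<and> finite \<sigma>"
    then obtain F where F: "F \<subseteq> underS continuum A" "finite F" "\<sigma> = f ` F"
      by (metis finite_subset_image)
    show "infinite (\<Inter>\<sigma>)"
    proof (cases "F = {}")
      case False
      \<comment> \<open>The tower built so far decreases modulo finite sets, so its member of
        largest index is almost contained in the whole intersection.\<close>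
      then obtain M where M: "M \<in> F" "\<forall>x\<in>F. (x, M) \<in> continuum"
        using finite_max_continuum F by blast
      then have "finite (\<Union>B\<in>F. f M - f B)" using F dec M by (intro finite_UN_I) auto
      moreover have "f M \<subseteq> (\<Union>B\<in>F. f M - f B) \<union> \<Inter>\<sigma>" using F by auto
      ultimately show ?thesis using inf[of M] M F by (meson finite_Un finite_subset subsetD)
    qed (use F in simp)
  qed
  ultimately obtain b where b: "infinite b" "\<And>B. B \<in> underS continuum A \<Longrightarrow> finite (b - f B)"
    using pseudointersection_exists[OF assms, of ?A] inf
    by (auto simp: nontrivial_pseudointersection_def)
  \<comment> \<open>The pseudointersection \<open>b\<close> need not decide \<open>A\<close>; a
    piece of it that is infinite does.\<close>
  have split: "infinite (b \<inter> A) \<or> infinite (b \<inter> - A)"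
    using b(1) by (metis Int_UNIV_right Compl_partition Int_Un_distrib finite_UnI)
  have sub: "finite (c - f B)" if "c \<subseteq> b" "B \<in> underS continuum A" for c B
    using b(2)[OF that(2)] by (rule rev_finite_subset) (use that in auto)
  from split show "\<exists>r. infinite r \<and> (\<forall>B\<in>underS continuum A. finite (r - f B)) \<and> (r \<subseteq> A \<or> r \<subseteq> - A)"
  proof
    assume "infinite (b \<inter> A)"
    then show ?thesis using sub by (intro exI[of _ "b \<inter> A"]) auto
  next
    assume "infinite (b \<inter> - A)"
    then show ?thesis using sub by (intro exI[of _ "b \<inter> - A"]) auto
  qed
qed

text \<open>The sets that almost contain some member of the tower form the ultrafilter. Countably
  many indices have an upper bound in c, and the member of the tower at that bound is a
  pseudointersection.\<close>

lemma P_point_exists: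
  assumes "pseudointersection_number =o continuum"
  shows "\<exists>V. P_point_ultrafilter V"
proof -
  obtain b where inf: "\<And>A. infinite (b A)"
    and dec0: "\<And>A B. B \<in> underS continuum A \<Longrightarrow> finite (b A - b B)"
    and decide: "\<And>A. b A \<subseteq> A \<or> b A \<subseteq> - A"
    using tower_exists[OF assms] by metis
  have dec: "finite (b A - b B)" if "(B, A) \<in> continuum" for A B
    using dec0[of B A] that by (cases "A = B") (auto simp: underS_def)
  define V where "V = {A. \<exists>x. finite (b x - A)}"
  have pseudo: "\<exists>Y\<in>V. \<forall>A\<in>X. finite (Y - A)" if "countable X" "X \<subseteq> V" for X
  proof -
    have "\<forall>A\<in>X. \<exists>x. finite (b x - A)" using that by (auto simp: V_def)
    then obtain x where x: "\<And>A. A \<in> X \<Longrightarrow> finite (b (x A) - A)" by metis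
    have "bounded_in continuum (x ` X)"
      using that by (intro countable_bounded_continuum) auto
    then obtain y where y: "\<And>A. A \<in> X \<Longrightarrow> (x A, y) \<in> continuum"
      by (auto simp: bounded_in_def)
    have "finite (b y - A)" if "A \<in> X" for A
    proof -
      have "finite ((b y - b (x A)) \<union> (b (x A) - A))" using x y dec that by blast
      then show ?thesis by (rule rev_finite_subset) auto
    qed
    moreover have "b y \<in> V" unfolding V_def by (auto intro: exI[of _ y])
    ultimately show ?thesis by blast
  qed
  have V_infinite: "infinite A" if "A \<in> V" for A
  proof
    assume "finite A"
    moreover obtain x where "finite (b x - A)" using \<open>A \<in> V\<close> by (auto simp: V_def)
    ultimately show False using inf[of x] by (metis finite_Diff2)
  qed
  have "ultrafilter V"
    unfolding ultrafilter_def
  proof (intro conjI ballI allI impI)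
    show "UNIV \<in> V" by (simp add: V_def)
    show "{} \<notin> V" using V_infinite by blast
    show "A \<in> V \<or> - A \<in> V" for A
      using decide[of A] unfolding V_def by (metis Diff_eq_empty_iff finite.emptyI mem_Collect_eq)
    show "B \<in> V" if "A \<in> V" "A \<subseteq> B" for A B
    proof -
      obtain x where "finite (b x - A)" using \<open>A \<in> V\<close> by (auto simp: V_def)
      then have "finite (b x - B)" by (rule rev_finite_subset) (use that in auto)
      then show ?thesis by (auto simp: V_def)
    qed
    show "A \<inter> B \<in> V" if AB: "A \<in> V" "B \<in> V" for A B
    proof -
      obtain Y where Y: "Y \<in> V" "finite (Y - A)" "finite (Y - B)"
        using pseudo[of "{A, B}"] AB by auto
      then obtain x where x: "finite (b x - Y)" by (auto simp: V_def)
      have "finite ((b x - Y) \<union> (Y - A) \<union> (Y - B))" using x Y by simp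
      then have "finite (b x - A \<inter> B)" by (rule rev_finite_subset) auto
      then show ?thesis by (auto simp: V_def)
    qed
  qed
  moreover have "nonprincipal V"
    unfolding nonprincipal_def
  proof
    assume "\<exists>n. V = {A. n \<in> A}"
    then obtain n where "{n} \<in> V" by auto
    then show False using V_infinite by blast
  qed
  ultimately have "P_point_ultrafilter V"
  proof unfold_locales
    fix X :: "nat \<Rightarrow> nat set" assume "range X \<subseteq> V"
    then show "\<exists>Y\<in>V. \<forall>k. finite (Y - X k)" using pseudo[of "range X"] by auto
  qed
  then show ?thesis ..
qed

section \<open>Infinite bounded subfamilies\<close>

text \<open>One subsequence has to serve all rows \<open>n\<close> in \<open>E\<close>. Stage
  \<open>j\<close> of the construction controls the rows up to \<open>j\<close>, so each row leaves
  only finitely many terms uncontrolled.\<close>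

lemma (in P_point_ultrafilter) convergent_rows_subsequence:
  fixes A :: "nat \<Rightarrow> nat \<Rightarrow> nat set"
  assumes A: "\<And>k n. n \<in> E \<Longrightarrow> A k n \<in> V"
    and L: "\<And>n. n \<in> E \<Longrightarrow> L n \<in> V"
    and conv: "\<And>n N. n \<in> E \<Longrightarrow> \<forall>\<^sub>F k in sequentially. A k n \<inter> {..<N} = L n \<inter> {..<N}"
  shows "\<exists>r :: nat \<Rightarrow> nat. strict_mono r \<and> (\<forall>n\<in>E. (\<Inter>i. A (r i) n) \<in> V)"
proof -
  \<comment> \<open>Cutting the pseudointersection down to the limit \<open>L n\<close> lets
    convergence push the errors \<open>Y n - A k n\<close> beyond any given number.\<close>
  have "\<exists>Y. n \<in> E \<longrightarrow> Y \<in> V \<and> Y \<subseteq> L n \<and> (\<forall>k. finite (Y - A k n))" for n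
  proof (cases "n \<in> E")
    case True
    then obtain Y where Y: "Y \<in> V" "\<And>k. finite (Y - A k n)"
      using pseudointersection[of "\<lambda>k. A k n"] A by auto
    have "finite (Y \<inter> L n - A k n)" for k
      using Y(2)[of k] by (rule rev_finite_subset) auto
    then show ?thesis using Y L True Int_mem by (intro exI[of _ "Y \<inter> L n"]) auto
  qed auto
  then obtain Y where Y: "\<And>n. n \<in> E \<Longrightarrow> Y n \<in> V" "\<And>n. n \<in> E \<Longrightarrow> Y n \<subseteq> L n"
    "\<And>n k. n \<in> E \<Longrightarrow> finite (Y n - A k n)" by metis
  \<comment> \<open>In a triple \<open>(k, m, m')\<close>, \<open>k\<close> is the chosen term and
    \<open>{m..<m'}\<close> contains the errors of the rows up to \<open>j\<close>. The next
    interval starts at \<open>m'\<close>.\<close>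
  let ?P = "\<lambda>j (k, m, m'). m < m' \<and> (\<forall>n\<in>E. n \<le> j \<longrightarrow> Y n - A k n \<subseteq> {m..<m'})"
  let ?Q = "\<lambda>(j::nat) (k :: nat, m :: nat, m' :: nat) (k2, m2, m2' :: nat). k < k2 \<and> m2 = m'"
  have step: "\<exists>k m'. k0 < k \<and> ?P j (k, m, m')" for k0 j m :: nat
  proof -
    have "\<forall>\<^sub>F k in sequentially. \<forall>n\<in>E \<inter> {..j}. A k n \<inter> {..<m} = L n \<inter> {..<m}"
      using conv by (intro eventually_ball_finite) auto
    then have "\<forall>\<^sub>F k in sequentially. k0 < k \<and> (\<forall>n\<in>E \<inter> {..j}. A k n \<inter> {..<m} = L n \<inter> {..<m})"
      using eventually_gt_at_top eventually_conj by blast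
    then have "\<exists>k. k0 < k \<and> (\<forall>n\<in>E \<inter> {..j}. A k n \<inter> {..<m} = L n \<inter> {..<m})"
      by (rule eventually_happens'[OF sequentially_bot])
    then obtain k where "k0 < k" "\<forall>n\<in>E \<inter> {..j}. A k n \<inter> {..<m} = L n \<inter> {..<m}" by blast
    then have k: "k0 < k" "\<And>n. n \<in> E \<Longrightarrow> n \<le> j \<Longrightarrow> A k n \<inter> {..<m} = L n \<inter> {..<m}"
      by simp_all
    have "finite (\<Union>n\<in>E \<inter> {..j}. Y n - A k n)" using Y(3) by auto
    then obtain M where M: "\<And>n x. n \<in> E \<Longrightarrow> n \<le> j \<Longrightarrow> x \<in> Y n - A k n \<Longrightarrow> x < M"
      unfolding finite_nat_set_iff_bounded by auto
    \<comment> \<open>The maximum with \<open>Suc m\<close> keeps the interval nonempty even if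
      there are no errors.\<close>
    have "Y n - A k n \<subseteq> {m..<max M (Suc m)}" if "n \<in> E" "n \<le> j" for n
    proof
      fix x assume x: "x \<in> Y n - A k n"
      then have "x < M" using M that by blast
      moreover have "\<not> x < m"
        using k(2)[OF that] x Y(2)[OF that(1)] by blast
      ultimately show "x \<in> {m..<max M (Suc m)}" by auto
    qed
    then show ?thesis using k(1) by (intro exI[of _ k] exI[of _ "max M (Suc m)"]) auto
  qed
  have "\<exists>f. \<forall>j. ?P j (f j) \<and> ?Q j (f j) (f (Suc j))"
  proof (rule dependent_nat_choice)
    show "\<exists>x. ?P 0 x" using step[of 0 0 0] by blast
  next
    fix x j assume "?P j x"
    obtain k m m' where x: "x = (k, m, m')" by (cases x)
    obtain k2 m2 where "k < k2" "?P (Suc j) (k2, m', m2)" using step[of k "Suc j" m'] by blast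
    then show "\<exists>y. ?P (Suc j) y \<and> ?Q j x y"
      unfolding x by (intro exI[of _ "(k2, m', m2)"]) simp
  qed
  then obtain f where f: "\<forall>j. ?P j (f j) \<and> ?Q j (f j) (f (Suc j))" ..
  have fP: "?P j (f j)" for j using f[THEN spec, of j] by (rule conjunct1)
  have fQ: "?Q j (f j) (f (Suc j))" for j using f[THEN spec, of j] by (rule conjunct2)
  define k m where "k j = fst (f j)" and "m j = fst (snd (f j))" for j
  have m': "snd (snd (f j)) = m (Suc j)" for j
    using fQ[of j] by (auto simp: m_def split: prod.splits)
  have k_mono: "strict_mono k"
    unfolding strict_mono_Suc_iff
  proof
    fix j
    show "k j < k (Suc j)" using fQ[of j] by (auto simp: k_def split: prod.splits)
  qed
  have m_less: "m j < m (Suc j)" for j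
    using fP[of j] m'[of j] by (auto simp: m_def split: prod.splits)
  then have m_mono: "mono m" by (simp add: mono_iff_le_Suc less_imp_le)
  have interval: "Y n - A (k j) n \<subseteq> {m j..<m (Suc j)}" if "n \<in> E" "n \<le> j" for n j
    using fP[of j] m'[of j] that by (auto simp: m_def k_def split: prod.splits)
  have disjoint: "{m i..<m (Suc i)} \<inter> {m j..<m (Suc j)} = {}" if "i < j" for i j
    using monoD[OF m_mono, of "Suc i" j] that by auto
  \<comment> \<open>\<open>Z\<close> is the union of the even intervals. If it lies in
    \<open>V\<close>, it avoids the odd ones and the odd stages are kept; otherwise its complement
    avoids the even ones.\<close>
  define Z where "Z = (\<Union>i. {m (2 * i)..<m (Suc (2 * i))})"
  have half: ?thesis
    if r: "strict_mono r" and W: "W \<in> V" and avoid: "\<And>i. W \<inter> {m (r i)..<m (Suc (r i))} = {}"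
    for r :: "nat \<Rightarrow> nat" and W
  proof (intro exI[of _ "k \<circ> r"] conjI ballI)
    show "strict_mono (k \<circ> r)" using k_mono r by (simp add: strict_mono_def)
  next
    fix n assume n: "n \<in> E"
    \<comment> \<open>Row \<open>n\<close> is controlled from \<open>i = n\<close> on, as
      \<open>n \<le> i \<le> r i\<close>; the earlier terms are met by a finite
      intersection.\<close>
    have "(\<Inter>i\<in>{..<n}. A (k (r i)) n) \<in> V" using A n by (intro INT_mem) auto
    then have "Y n \<inter> W \<inter> (\<Inter>i\<in>{..<n}. A (k (r i)) n) \<in> V"
      using Y(1)[OF n] W Int_mem by blast
    then show "(\<Inter>i. A ((k \<circ> r) i) n) \<in> V"
    proof (rule superset_mem, intro subsetI INT_I)
      fix x i assume x: "x \<in> Y n \<inter> W \<inter> (\<Inter>i\<in>{..<n}. A (k (r i)) n)"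
      show "x \<in> A ((k \<circ> r) i) n"
      proof (cases "i < n")
        case False
        then have "n \<le> r i" using strict_mono_imp_increasing[OF r, of i] by simp
        then have "Y n - A (k (r i)) n \<subseteq> {m (r i)..<m (Suc (r i))}" using interval n by blast
        then show ?thesis using x avoid[of i] by auto
      qed (use x in auto)
    qed
  qed
  show ?thesis
  proof (cases "Z \<in> V")
    case True
    show ?thesis
    proof (rule half[OF _ True, of "\<lambda>i. Suc (2 * i)"])
      show "strict_mono (\<lambda>i. Suc (2 * i) :: nat)" by (simp add: strict_mono_def)
      fix i
      have "{m (2 * j)..<m (Suc (2 * j))} \<inter> {m (Suc (2 * i))..<m (Suc (Suc (2 * i)))} = {}" for j
      proof -
        have "2 * j < Suc (2 * i) \<or> Suc (2 * i) < 2 * j" by presburger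
        then show ?thesis
        proof
          assume "2 * j < Suc (2 * i)"
          then show ?thesis by (rule disjoint)
        next
          assume "Suc (2 * i) < 2 * j"
          then show ?thesis by (subst Int_commute) (rule disjoint)
        qed
      qed
      then show "Z \<inter> {m (Suc (2 * i))..<m (Suc (Suc (2 * i)))} = {}"
        unfolding Z_def by blast
    qed
  next
    case False
    then have Z: "- Z \<in> V" by (simp add: Compl_mem_iff)
    show ?thesis
      by (rule half[OF _ Z, of "\<lambda>i. 2 * i"]) (auto simp: strict_mono_def Z_def)
  qed
qed

text \<open>Some \<open>x\<close> is such that every basic neighbourhood of
  \<open>(\<phi> x, \<psi> x)\<close> has an infinite preimage; otherwise countably many finite sets
  would cover an uncountable one. The points \<open>s k\<close> are distinct, though their values
  may coincide.\<close>

lemma accumulation_sequence: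
  fixes \<phi> \<psi> :: "nat set \<Rightarrow> nat set"
  obtains s x where "inj s"
    "\<And>k. \<phi> (s k) \<inter> {..<k} = \<phi> x \<inter> {..<k}" "\<And>k. \<psi> (s k) \<inter> {..<k} = \<psi> x \<inter> {..<k}"
proof -
  \<comment> \<open>\<open>S (N, a, b)\<close> is the preimage of the basic open set given by the
    traces \<open>a\<close> and \<open>b\<close> below \<open>N\<close>. Traces are finite, so only
    countably many triples matter.\<close>
  define S where "S = (\<lambda>(N, a, b). {y. \<phi> y \<inter> {..<N::nat} = a \<and> \<psi> y \<inter> {..<N} = b})"
  have "\<exists>x. \<forall>N. infinite (S (N, \<phi> x \<inter> {..<N}, \<psi> x \<inter> {..<N}))"
  proof (rule ccontr)
    assume "\<not> ?thesis"
    then have fin: "\<forall>x. \<exists>N. finite (S (N, \<phi> x \<inter> {..<N}, \<psi> x \<inter> {..<N}))" by blast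
    let ?I = "{p \<in> UNIV \<times> Collect finite \<times> Collect finite. finite (S p)}"
    have "countable ?I"
      by (rule countable_subset[of _ "UNIV \<times> Collect finite \<times> Collect finite"])
        (auto intro!: countable_SIGMA simp: countable_Collect_finite)
    define C where "C = (\<Union>p\<in>?I. S p)"
    have "countable C"
      unfolding C_def using \<open>countable ?I\<close> by (intro countable_UN) (auto simp: countable_finite)
    moreover have "UNIV = C"
    proof (rule UNIV_eq_I)
      fix x
      obtain N where "finite (S (N, \<phi> x \<inter> {..<N}, \<psi> x \<inter> {..<N}))" using fin by blast
      then show "x \<in> C"
        unfolding C_def
        by (intro UN_I[of "(N, \<phi> x \<inter> {..<N}, \<psi> x \<inter> {..<N})"]) (auto simp: S_def)
    qed
    ultimately show False using uncountable_nat_sets by simp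
  qed
  then obtain x where x: "\<And>N. infinite (S (N, \<phi> x \<inter> {..<N}, \<psi> x \<inter> {..<N}))" by blast
  \<comment> \<open>\<open>F\<close> accumulates the points chosen earlier, so that picking
    \<open>y\<close> outside it makes the sequence injective.\<close>
  let ?P = "\<lambda>k (F, y). finite F \<and> y \<notin> F \<and> y \<in> S (k, \<phi> x \<inter> {..<k}, \<psi> x \<inter> {..<k})"
  let ?Q = "\<lambda>(k::nat) (F, y) (F', y' :: nat set). insert y F = F'"
  have step: "\<exists>y. ?P k (F, y)" if "finite F" for k F
  proof -
    have "S (k, \<phi> x \<inter> {..<k}, \<psi> x \<inter> {..<k}) - F \<noteq> {}"
      using that x[of k] Diff_infinite_finite infinite_imp_nonempty by blast
    with that show ?thesis by auto
  qed
  have "\<exists>f. \<forall>k. ?P k (f k) \<and> ?Q k (f k) (f (Suc k))"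
  proof (rule dependent_nat_choice)
    show "\<exists>z. ?P 0 z" using step[of "{}" 0] by blast
  next
    fix z k assume z: "?P k z"
    obtain F y where Fy: "z = (F, y)" by (cases z)
    obtain y' where "?P (Suc k) (insert y F, y')" using step[of "insert y F" "Suc k"] z Fy by auto
    then show "\<exists>z'. ?P (Suc k) z' \<and> ?Q k z z'"
      unfolding Fy by (intro exI[of _ "(insert y F, y')"]) simp
  qed
  then obtain f where f: "\<forall>k. ?P k (f k) \<and> ?Q k (f k) (f (Suc k))" ..
  have fP: "?P k (f k)" for k using f[THEN spec, of k] by (rule conjunct1)
  have fQ: "?Q k (f k) (f (Suc k))" for k using f[THEN spec, of k] by (rule conjunct2)
  define F s where "F k = fst (f k)" and "s k = snd (f k)" for k
  have F: "F (Suc k) = insert (s k) (F k)" for k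
    using fQ[of k] by (auto simp: F_def s_def split: prod.splits)
  have s: "s k \<notin> F k" "s k \<in> S (k, \<phi> x \<inter> {..<k}, \<psi> x \<inter> {..<k})" for k
    using fP[of k] by (auto simp: F_def s_def split: prod.splits)
  have "mono F" using F by (simp add: mono_iff_le_Suc subset_insertI)
  then have "s i \<noteq> s j" if "i < j" for i j
    using monoD[of F "Suc i" j] F[of i] s(1)[of j] that by auto
  then have "inj s" by (rule linorder_injI)
  then show thesis by (rule that) (use s(2) in \<open>auto simp: S_def\<close>)
qed

section \<open>The Fubini square\<close>

definition fubini_square :: "nat set set \<Rightarrow> nat set set" where
  "fubini_square V = {A. {n. row n A \<in> V} \<in> V}"

context free_ultrafilter
begin

lemma free_ultrafilter_fubini_square: "free_ultrafilter (fubini_square U)"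
proof
  show "ultrafilter (fubini_square U)"
    unfolding ultrafilter_def
  proof (intro conjI ballI allI impI)
    show "UNIV \<in> fubini_square U" by (simp add: fubini_square_def row_def UNIV_mem)
    show "{} \<notin> fubini_square U" by (simp add: fubini_square_def row_def empty_notin)
    show "A \<in> fubini_square U \<or> - A \<in> fubini_square U" for A
    proof -
      have "{n. row n (- A) \<in> U} = - {n. row n A \<in> U}"
        by (auto simp: row_Compl Compl_mem_iff)
      then show ?thesis by (auto simp: fubini_square_def Compl_mem_iff)
    qed
    show "B \<in> fubini_square U" if "A \<in> fubini_square U" "A \<subseteq> B" for A B
    proof -
      have "{n. row n A \<in> U} \<in> U" using that by (simp add: fubini_square_def)
      then have "{n. row n B \<in> U} \<in> U"
        by (rule superset_mem) (auto intro: superset_mem[OF _ row_mono[OF that(2)]])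
      then show ?thesis by (simp add: fubini_square_def)
    qed
    show "A \<inter> B \<in> fubini_square U" if "A \<in> fubini_square U" "B \<in> fubini_square U" for A B
    proof -
      have "{n. row n A \<in> U} \<inter> {n. row n B \<in> U} \<in> U"
        using that Int_mem by (simp add: fubini_square_def)
      then have "{n. row n (A \<inter> B) \<in> U} \<in> U"
        by (rule superset_mem) (auto simp: row_Int Int_mem)
      then show ?thesis by (simp add: fubini_square_def)
    qed
  qed
next
  show "nonprincipal (fubini_square U)"
    unfolding nonprincipal_def
  proof
    assume "\<exists>p. fubini_square U = {A. p \<in> A}"
    then obtain p where "{p} \<in> fubini_square U" by auto
    then have "{n. row n {p} \<in> U} \<noteq> {}"
      using empty_notin unfolding fubini_square_def by force
    then obtain n where "row n {p} \<in> U" by auto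
    moreover have "row n {p} \<subseteq> {snd (prod_decode p)}" by (auto simp: row_def)
    ultimately show False using infinite_mem finite_subset by blast
  qed
qed

text \<open>The sets of points beyond column index \<open>i\<close> lie in the square. A set almost
  contained in all of them has only finite rows, so it does not.\<close>

lemma not_P_point_fubini_square: "\<not> P_point (fubini_square U)"
proof
  interpret W: free_ultrafilter "fubini_square U" by (rule free_ultrafilter_fubini_square)
  assume P: "P_point (fubini_square U)"
  define C where "C i = {p. i < fst (prod_decode p)}" for i :: nat
  have row_C: "row n (C i) = (if i < n then UNIV else {})" for n i
    by (auto simp: row_def C_def)
  have "C i \<in> fubini_square U" for i
  proof -
    have "- {..i} \<in> U" using finite_notin Compl_mem_iff by blast
    then have "{n. row n (C i) \<in> U} \<in> U"
      by (rule superset_mem) (auto simp: row_C UNIV_mem)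
    then show ?thesis by (simp add: fubini_square_def)
  qed
  then have "range C \<subseteq> Field (almost_superset_order (fubini_square U))"
    by (auto simp: W.Field_almost_superset_order)
  moreover have "countable (range C)" by simp
  ultimately have "bounded_in (almost_superset_order (fubini_square U)) (range C)"
    using P unfolding P_point_def card_directed_def countable_iff_ordLess_cardSuc[symmetric]
    by blast
  then obtain B where B: "B \<in> fubini_square U" "\<And>i. finite (B - C i)"
    by (auto simp: bounded_in_def almost_superset_order_def W.Field_almost_superset_order)
  have "{n. row n B \<in> U} \<noteq> {}"
    using B(1) empty_notin unfolding fubini_square_def by force
  then obtain n where n: "row n B \<in> U" by auto
  have "(\<lambda>m. prod_encode (n, m)) ` row n B \<subseteq> B - C n" by (auto simp: row_def C_def)
  then have "finite ((\<lambda>m. prod_encode (n, m)) ` row n B)" using B(2) finite_subset by blast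
  then have "finite (row n B)" by (rule finite_imageD) (auto simp: inj_on_def)
  then show False using n infinite_mem by blast
qed

end

text \<open>The subsequence lemma is applied twice: first to the sets of rows that lie in
  \<open>V\<close>, giving one set of good row indices common to all terms, then to the rows with
  these indices.\<close>

lemma (in P_point_ultrafilter) fubini_square_infinite_bounded:
  assumes \<phi>: "\<And>x :: nat set. \<phi> x \<in> fubini_square V"
  shows "\<exists>X. infinite X \<and> (\<Inter>x\<in>X. \<phi> x) \<in> fubini_square V"
proof -
  define D where "D A = {n. row n A \<in> V}" for A
  have DV: "D (\<phi> x) \<in> V" for x using \<phi> by (simp add: D_def fubini_square_def)
  obtain s x where s: "inj s" "\<And>k. \<phi> (s k) \<inter> {..<k} = \<phi> x \<inter> {..<k}"
    "\<And>k. D (\<phi> (s k)) \<inter> {..<k} = D (\<phi> x) \<inter> {..<k}"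
    by (rule accumulation_sequence[of \<phi> "\<lambda>x. D (\<phi> x)"]) (rule that)
  have agree: "A \<inter> {..<N} = B \<inter> {..<N}"
    if "A \<inter> {..<k} = B \<inter> {..<k}" "N \<le> k" for A B :: "nat set" and N k
  proof -
    have *: "C \<inter> {..<N} = (C \<inter> {..<k}) \<inter> {..<N}" for C using that(2) by auto
    show ?thesis by (simp only: *[of A] *[of B] that(1))
  qed
  have "\<forall>\<^sub>F k in sequentially. D (\<phi> (s k)) \<inter> {..<N} = D (\<phi> x) \<inter> {..<N}" for N
    using eventually_ge_at_top[of N] by eventually_elim (rule agree[OF s(3)])
  \<comment> \<open>The sets of good indices are treated as a single row, with dummy index
    \<open>0\<close>.\<close>
  then obtain r :: "nat \<Rightarrow> nat" where r: "strict_mono r" "(\<Inter>i. D (\<phi> (s (r i)))) \<in> V"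
    using convergent_rows_subsequence[of "{0}" "\<lambda>k n. D (\<phi> (s k))" "\<lambda>n. D (\<phi> x)"] DV by auto
  \<comment> \<open>Intersecting with \<open>D (\<phi> x)\<close> ensures that the limit rows also
    lie in \<open>V\<close>, as the second application demands.\<close>
  define E where "E = (\<Inter>i. D (\<phi> (s (r i)))) \<inter> D (\<phi> x)"
  have E: "E \<in> V" using r DV Int_mem by (simp add: E_def)
  \<comment> \<open>Agreement below a bound \<open>M\<close> for the codes of the pairs
    \<open>(n, m)\<close> with \<open>m < N\<close> gives agreement of the \<open>n\<close>-th rows
    below \<open>N\<close>.\<close>
  have conv: "\<forall>\<^sub>F k in sequentially. row n (\<phi> (s (r k))) \<inter> {..<N} = row n (\<phi> x) \<inter> {..<N}" for n N
  proof -
    have "finite ((\<lambda>m. prod_encode (n, m)) ` {..<N})" by simp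
    then obtain M where M: "\<And>m. m < N \<Longrightarrow> prod_encode (n, m) < M"
      unfolding finite_nat_set_iff_bounded by auto
    show ?thesis
      using eventually_ge_at_top[of M]
    proof eventually_elim
      case (elim k)
      then have "M \<le> r k" using strict_mono_imp_increasing[OF r(1), of k] by simp
      then have "\<phi> (s (r k)) \<inter> {..<M} = \<phi> x \<inter> {..<M}" by (rule agree[OF s(2)])
      then show ?case using M by (auto simp: row_def)
    qed
  qed
  have "\<exists>q :: nat \<Rightarrow> nat. strict_mono q \<and> (\<forall>n\<in>E. (\<Inter>i. row n (\<phi> (s (r (q i))))) \<in> V)"
  proof (rule convergent_rows_subsequence[where L = "\<lambda>n. row n (\<phi> x)"])
    show "row n (\<phi> (s (r k))) \<in> V" if "n \<in> E" for k n
      using that by (simp add: E_def D_def)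
    show "row n (\<phi> x) \<in> V" if "n \<in> E" for n
      using that by (simp add: E_def D_def)
  qed (rule conv)
  then obtain q :: "nat \<Rightarrow> nat" where q: "strict_mono q"
    "\<And>n. n \<in> E \<Longrightarrow> (\<Inter>i. row n (\<phi> (s (r (q i))))) \<in> V" by blast
  let ?X = "range (\<lambda>i. s (r (q i)))"
  have "inj (s \<circ> r \<circ> q)"
    using s(1) r(1) q(1) by (intro inj_compose) (auto simp: strict_mono_imp_inj_on)
  then have "infinite ?X" using range_inj_infinite by (auto simp: comp_def)
  moreover have "{n. row n (\<Inter>x\<in>?X. \<phi> x) \<in> V} \<in> V"
    using E by (rule superset_mem) (use q(2) in \<open>auto simp: row_INT\<close>)
  ultimately show ?thesis by (auto simp: fubini_square_def)
qed

text \<open>Under any map, infinitely many singletons have values whose intersection stays in the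
  ultrafilter, hence a bounded image, although these singletons are unbounded.\<close>

lemma (in P_point_ultrafilter) not_finite_subsets_tukey_le_fubini_square:
  "\<not> finite_subsets_order (Field continuum) \<le>\<^sub>T superset_order (fubini_square V)"
proof
  interpret W: free_ultrafilter "fubini_square V" by (rule free_ultrafilter_fubini_square)
  have single: "{x} \<in> Field (finite_subsets_order (Field continuum))" for x
    by (auto simp: Field_finite_subsets_order)
  assume "finite_subsets_order (Field continuum) \<le>\<^sub>T superset_order (fubini_square V)"
  then obtain g where g: "tukey_map (finite_subsets_order (Field continuum))
      (superset_order (fubini_square V)) g"
    by (auto simp: tukey_le_def)
  then have gV: "g {x} \<in> fubini_square V" for x
    using single by (auto simp: tukey_map_def W.Field_superset_order)
  then obtain X where X: "infinite X" "(\<Inter>x\<in>X. g {x}) \<in> fubini_square V"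
    using fubini_square_infinite_bounded[of "\<lambda>x. g {x}"] by blast
  have "bounded_in (superset_order (fubini_square V)) (g ` (\<lambda>x. {x}) ` X)"
    unfolding bounded_in_def W.Field_superset_order
    using X(2) gV by (intro bexI[of _ "\<Inter>x\<in>X. g {x}"]) (auto simp: superset_order_def)
  moreover have "\<not> bounded_in (superset_order (fubini_square V)) (g ` (\<lambda>x. {x}) ` X)"
    if "\<not> bounded_in (finite_subsets_order (Field continuum)) ((\<lambda>x. {x}) ` X)"
  proof (rule g[unfolded tukey_map_def, THEN conjunct2, rule_format], rule conjI)
    show "(\<lambda>x. {x}) ` X \<subseteq> Field (finite_subsets_order (Field continuum))"
      using single by auto
  qed (fact that)
  ultimately have "bounded_in (finite_subsets_order (Field continuum)) ((\<lambda>x. {x}) ` X)" by blast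
  then show False using X(1) bounded_singletons_finite_subsets_order by blast
qed

theorem theorem3p11:
  assumes "diamond continuum (cof_set continuum natLeq)"
    and "pseudointersection_number =o continuum"
  shows "\<exists>U. ultrafilter U \<and> nonprincipal U \<and> \<not> P_point U \<and>
    continuum <\<^sub>T almost_superset_order U \<and>
    almost_superset_order U \<le>\<^sub>T superset_order U \<and>
    superset_order U <\<^sub>T finite_subsets_order (Field continuum)"
proof -
  obtain V where "P_point_ultrafilter V" using P_point_exists[OF assms(2)] by blast
  then interpret V: P_point_ultrafilter V .
  interpret U: free_ultrafilter "fubini_square V" by (rule V.free_ultrafilter_fubini_square)
  show ?thesis
    unfolding tukey_less_def
  proof (intro exI[of _ "fubini_square V"] conjI)
    show "\<not> almost_superset_order (fubini_square V) \<le>\<^sub>T continuum"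
      using U.tukey_le_continuum_imp_P_point V.not_P_point_fubini_square by blast
  qed (fact U.ultra U.free V.not_P_point_fubini_square U.continuum_tukey_le[OF assms(2)]
      U.almost_superset_order_tukey_le U.superset_order_tukey_le
      V.not_finite_subsets_tukey_le_fubini_square)+
qed

end
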